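(* Let $n\ge 1$ and let $u:\mathbf{D}\to\mathbb{C}^n$ be a $\mathcal{C}^1$ map such that for some constant $K>0$ $$\left|\frac{\partial u}{\partial\overline z}\right|\le K\,|u|^{1/2}\left|\frac{\partial u}{\partial z}\right|\qquad\text{on }\mathbf{D}.$$ If $u$ vanishes on some non-empty open subset of $\mathbf{D}$, then $u\equiv 0$ on $\mathbf{D}$.
   Context: $\mathbf{D}$ denotes the open unit disc in $\mathbb{C}$, with coordinate $z=x+iy$; $\frac{\partial}{\partial z}=\frac12\big(\frac{\partial}{\partial x}-i\frac{\partial}{\partial y}\big)$ and $\frac{\partial}{\partial\overline z}=\frac12\big(\frac{\partial}{\partial x}+i\frac{\partial}{\partial y}\big)$ act componentwise on $\mathbb{C}^n$-valued maps, and $|\cdot|$ is the Euclidean norm on $\mathbb{C}^n$. *)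

theory Defs
  imports "HOL-Analysis.Analysis"
begin

text \<open>
  The norm of \<^typ>\<open>complex ^ 'n\<close> is the Euclidean norm, and \<open>c *s v\<close> is multiplication of the
  vector \<open>v\<close> by the complex scalar \<open>c\<close>.
\<close>

definition partial_x :: "(complex \<Rightarrow> complex ^ 'n) \<Rightarrow> complex \<Rightarrow> complex ^ 'n" where
  "partial_x u z = vector_derivative (\<lambda>x. u (Complex x (Im z))) (at (Re z))"

definition partial_y :: "(complex \<Rightarrow> complex ^ 'n) \<Rightarrow> complex \<Rightarrow> complex ^ 'n" where
  "partial_y u z = vector_derivative (\<lambda>y. u (Complex (Re z) y)) (at (Im z))"

definition partial_z :: "(complex \<Rightarrow> complex ^ 'n) \<Rightarrow> complex \<Rightarrow> complex ^ 'n" where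
  "partial_z u z = (1 / 2) *s (partial_x u z - \<i> *s partial_y u z)"

definition partial_zbar :: "(complex \<Rightarrow> complex ^ 'n) \<Rightarrow> complex \<Rightarrow> complex ^ 'n" where
  "partial_zbar u z = (1 / 2) *s (partial_x u z + \<i> *s partial_y u z)"

text \<open>
  Continuous differentiability on an open set in the real sense: derivatives are
  \<open>\<real>\<close>-linear, and the derivative is continuous for the operator norm.
\<close>

definition C1_on :: "'a::real_normed_vector set \<Rightarrow> ('a \<Rightarrow> 'b::real_normed_vector) \<Rightarrow> bool" where
  "C1_on S f \<longleftrightarrow>
     (\<exists>f' :: 'a \<Rightarrow> 'a \<Rightarrow>\<^sub>L 'b.
        (\<forall>z\<in>S. (f has_derivative blinfun_apply (f' z)) (at z)) \<and> continuous_on S f')"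

end

theory Submission
  imports Defs
begin

text \<open>
  Let \<open>u\<close> vanish on a disc whose closure lies in the unit disc. In logarithmic polar coordinates
  \<open>(x, y)\<close> around its centre, \<open>u\<close> is \<open>2\<pi>\<close>-periodic in \<open>y\<close>, vanishes for \<open>x \<le> 0\<close>, and satisfies the same
  differential inequality, which is conformally invariant. Suppose \<open>\<bar>u\<bar> \<le> \<delta>\<close> for \<open>x \<le> b \<le> s\<close>. The factor
  \<open>\<bar>u\<bar>\<close> in the squared inequality allows a Carleman weight \<open>exp (2 * \<phi> x)\<close> with \<open>\<phi>'' = \<tau> / (2 * s)\<close>
  and slope of size \<open>\<tau> = 1 / (16 * K\<^sup>2 * \<delta> * s)\<close>. Hence for \<open>a < b\<close> the supremum of \<open>\<bar>u\<bar>\<close> over \<open>x \<le> a\<close> is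
  smaller than \<open>\<delta>\<close> by a factor exponentially small in \<open>(b - a) * \<tau>\<close>. Since \<open>\<tau>\<close> grows as \<open>\<delta>\<close> decreases, this
  can be iterated infinitely often on strips of total width loss \<open>s / 2\<close>, so \<open>u = 0\<close> for \<open>x \<le> s / 2\<close>:
  the disc of zeros can be enlarged until it touches the unit circle.
\<close>

section \<open>Pointwise inequality and an exponential bound\<close>

text \<open>With \<open>W\<close> and \<open>Z\<close> half of \<open>a + c\<close> and
  \<open>a - c\<close>, the left side is the square of \<open>norm W\<close> minus that of
  \<open>norm (Z + p *\<^sub>R v)\<close>. The hypothesis bounds \<open>W\<close> by
  \<open>Z\<close>, and the negative square absorbs all of \<open>Z\<close> except a multiple of
  \<open>v\<close>. The application has \<open>a = ux\<close>, \<open>c = J uy\<close>,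
  \<open>v = u\<close> and \<open>p\<close> the slope of the weight.\<close>

lemma dbar_weight_ineq:
  fixes a c v :: "'a::real_inner"
  assumes "norm (a + c) \<le> k * norm (a - c)" and "2 * k\<^sup>2 \<le> 1"
  shows "inner a c + p * inner v c - p * inner v a - p\<^sup>2 * inner v v \<le> 2 * k\<^sup>2 * p\<^sup>2 * inner v v"
proof -
  define Z where "Z = (1/2) *\<^sub>R (a - c)"
  define W where "W = (1/2) *\<^sub>R (a + c)"
  define Y where "Y = Z + p *\<^sub>R v"
  have eq: "inner a c + p * inner v c - p * inner v a - p\<^sup>2 * inner v v = (norm W)\<^sup>2 - (norm Y)\<^sup>2"
    unfolding power2_norm_eq_inner Y_def W_def Z_def
    by (simp add: inner_simps inner_commute algebra_simps power2_eq_square)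
  have "norm W \<le> k * norm Z" using assms(1) by (simp add: W_def Z_def)
  then have "(norm W)\<^sup>2 \<le> (k * norm Z)\<^sup>2" by (intro power_mono) auto
  also have "\<dots> = k\<^sup>2 * (norm Z)\<^sup>2" by (simp add: power_mult_distrib)
  also have "\<dots> \<le> k\<^sup>2 * (2 * (norm Y)\<^sup>2 + 2 * p\<^sup>2 * inner v v)"
  proof (intro mult_left_mono)
    have "2 * (norm Y)\<^sup>2 + 2 * p\<^sup>2 * inner v v - (norm Z)\<^sup>2 = (norm (Z + (2 * p) *\<^sub>R v))\<^sup>2"
      unfolding power2_norm_eq_inner Y_def
      by (simp add: inner_simps inner_commute algebra_simps power2_eq_square)
    then show "(norm Z)\<^sup>2 \<le> 2 * (norm Y)\<^sup>2 + 2 * p\<^sup>2 * inner v v"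
      by (smt (verit) zero_le_power2)
  qed auto
  also have "\<dots> = 2 * k\<^sup>2 * (norm Y)\<^sup>2 + 2 * k\<^sup>2 * p\<^sup>2 * inner v v" by (simp add: algebra_simps)
  also have "\<dots> \<le> (norm Y)\<^sup>2 + 2 * k\<^sup>2 * p\<^sup>2 * inner v v"
    using mult_right_mono[OF assms(2), of "(norm Y)\<^sup>2"] by simp
  finally show ?thesis using eq by simp
qed

text \<open>The exponent 4 closes the later iteration: when \<open>t\<close> doubles, the right side
  drops by a factor 16.\<close>

lemma exp_minus_le_power4:
  fixes t :: real
  assumes "t > 0"
  shows "exp (- t) \<le> 256 / t ^ 4"
proof -
  have "(t / 4) ^ 4 \<le> (1 + t / 4) ^ 4" using assms by (intro power_mono) auto
  also have "\<dots> \<le> exp t" using exp_ge_one_plus_x_over_n_power_n[of 4 t] assms by simp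
  finally show ?thesis using assms by (simp add: exp_minus field_simps)
qed

section \<open>Periodic maps on a strip\<close>

text \<open>
  The first coordinate is the logarithm of the radius and the second one the angle;
  \<open>J\<close> plays the role of multiplication by \<open>\<i>\<close>.
\<close>

locale periodic_strip =
  fixes u ux uy :: "real \<Rightarrow> real \<Rightarrow> 'a::euclidean_space" and J :: "'a \<Rightarrow> 'a" and r K :: real
  assumes J_linear: "linear J"
    and J_norm: "norm (J v) = norm v"
    and J_skew: "inner (J v) w = - inner v (J w)"
    and has_ux: "x < r \<Longrightarrow> ((\<lambda>x. u x y) has_vector_derivative ux x y) (at x)"
    and has_uy: "x < r \<Longrightarrow> ((\<lambda>y. u x y) has_vector_derivative uy x y) (at y)"
    and cont_u: "continuous_on ({..<r} \<times> UNIV) (\<lambda>(x, y). u x y)"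
    and cont_ux: "continuous_on ({..<r} \<times> UNIV) (\<lambda>(x, y). ux x y)"
    and cont_uy: "continuous_on ({..<r} \<times> UNIV) (\<lambda>(x, y). uy x y)"
    and periodic: "u x (y + 2 * pi) = u x y"
    and zero: "x \<le> 0 \<Longrightarrow> u x y = 0"
    and r_pos: "r > 0" and K_pos: "K > 0"
    and dbar_le: "x < r \<Longrightarrow>
      norm (ux x y + J (uy x y)) \<le> K * sqrt (norm (u x y)) * norm (ux x y - J (uy x y))"
begin

lemma continuous_J [continuous_intros]: "continuous_on S f \<Longrightarrow> continuous_on S (\<lambda>x. J (f x))"
  using continuous_on_compose2[OF linear_continuous_on[of J UNIV]] J_linear linear_linear by blast

lemma continuous_u_comp [continuous_intros]:
  assumes "continuous_on S f" "continuous_on S g" "\<And>s. s \<in> S \<Longrightarrow> f s < r"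
  shows "continuous_on S (\<lambda>s. u (f s) (g s))"
  using continuous_on_compose2[OF cont_u continuous_on_Pair[OF assms(1,2)]] assms(3) by auto

lemma continuous_ux_comp [continuous_intros]:
  assumes "continuous_on S f" "continuous_on S g" "\<And>s. s \<in> S \<Longrightarrow> f s < r"
  shows "continuous_on S (\<lambda>s. ux (f s) (g s))"
  using continuous_on_compose2[OF cont_ux continuous_on_Pair[OF assms(1,2)]] assms(3) by auto

lemma continuous_uy_comp [continuous_intros]:
  assumes "continuous_on S f" "continuous_on S g" "\<And>s. s \<in> S \<Longrightarrow> f s < r"
  shows "continuous_on S (\<lambda>s. uy (f s) (g s))"
  using continuous_on_compose2[OF cont_uy continuous_on_Pair[OF assms(1,2)]] assms(3) by auto

section \<open>Circle integrals and their radial derivatives\<close>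

definition mass :: "real \<Rightarrow> real" where
  "mass x = integral {0..2 * pi} (\<lambda>y. inner (u x y) (u x y))"

text \<open>Quadratic form of the operator \<open>J\<close> composed with d/dy, which is symmetric
  on periodic maps, both factors being skew and commuting.\<close>

definition flux :: "real \<Rightarrow> real" where
  "flux x = integral {0..2 * pi} (\<lambda>y. inner (u x y) (J (uy x y)))"

text \<open>The second factor \<open>c\<close> is frozen in \<open>x\<close>, so no derivative of
  \<open>uy\<close> enters; it is later taken to be \<open>J (uy x y)\<close> at the base
  point.\<close>

lemma integral_inner_deriv:
  assumes x: "x < r" and c: "continuous_on UNIV c"
  shows "((\<lambda>t. integral {0..2 * pi} (\<lambda>y. inner (u t y) (c y))) has_real_derivative
           integral {0..2 * pi} (\<lambda>y. inner (ux x y) (c y))) (at x)"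
proof -
  note [continuous_intros] = continuous_on_compose2[OF c]
  have "((\<lambda>t. integral (cbox 0 (2 * pi)) (\<lambda>y. inner (u t y) (c y))) has_vector_derivative
           integral (cbox 0 (2 * pi)) (\<lambda>y. inner (ux x y) (c y))) (at x within {..<r})"
  proof (rule leibniz_rule_vector_derivative)
    fix t y :: real assume "t \<in> {..<r}"
    then have "((\<lambda>x. u x y) has_vector_derivative ux t y) (at t within {..<r})"
      using has_vector_derivative_at_within[OF has_ux[of t y]] by simp
    then show "((\<lambda>x. inner (u x y) (c y)) has_vector_derivative inner (ux t y) (c y)) (at t within {..<r})"
      by (rule bounded_linear.has_vector_derivative[OF bounded_linear_inner_left])
  next
    fix t assume "t \<in> {..<r}"
    then show "(\<lambda>y. inner (u t y) (c y)) integrable_on cbox 0 (2 * pi)"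
      by (intro integrable_continuous) (auto intro!: continuous_intros)
  next
    show "continuous_on ({..<r} \<times> cbox 0 (2 * pi)) (\<lambda>(t, y). inner (ux t y) (c y))"
      by (auto simp: split_beta intro!: continuous_intros)
  qed (use x in auto)
  moreover have "at x within {..<r} = at x"
    using x by (intro at_within_open) auto
  ultimately show ?thesis
    by (simp add: has_real_derivative_iff_has_vector_derivative)
qed

lemma strip_bounded:
  assumes "continuous_on ({..<r} \<times> UNIV) (\<lambda>(x, y). f x y)" and "b < r"
  obtains L where "L > 0" "\<And>x y. x \<in> {a..b} \<Longrightarrow> y \<in> {0..2 * pi} \<Longrightarrow> norm (f x y) \<le> L"
proof -
  have "continuous_on ({a..b} \<times> {0..2 * pi}) (\<lambda>(x, y). f x y)"
    using assms(2) by (intro continuous_on_subset[OF assms(1)]) auto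
  then have "compact ((\<lambda>(x, y). f x y) ` ({a..b} \<times> {0..2 * pi}))"
    by (intro compact_continuous_image compact_Times) auto
  then obtain L where L: "L > 0" "\<And>v. v \<in> (\<lambda>(x, y). f x y) ` ({a..b} \<times> {0..2 * pi}) \<Longrightarrow> norm v \<le> L"
    using compact_imp_bounded bounded_pos by metis
  show ?thesis
  proof (rule that[OF L(1)])
    fix x y assume "x \<in> {a..b}" "y \<in> {0..2 * pi}"
    then show "norm (f x y) \<le> L" by (intro L(2)) force
  qed
qed

lemma lipschitz_x:
  assumes "b < r" "x \<in> {a..b}" "x' \<in> {a..b}" "\<And>x. x \<in> {a..b} \<Longrightarrow> norm (ux x y) \<le> L"
  shows "norm (u x y - u x' y) \<le> L * \<bar>x - x'\<bar>"
proof -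
  have "norm (u x y - u x' y) \<le> L * norm (x - x')"
  proof (rule differentiable_bound[of "{a..b}" _ "\<lambda>x h. h *\<^sub>R ux x y"])
    fix x assume x: "x \<in> {a..b}"
    then show "((\<lambda>x. u x y) has_derivative (\<lambda>h. h *\<^sub>R ux x y)) (at x within {a..b})"
      using has_ux[of x y] assms(1) has_derivative_at_withinI unfolding has_vector_derivative_def by fastforce
    show "onorm (\<lambda>h. h *\<^sub>R ux x y) \<le> L"
      using assms(4)[OF x] by (intro onorm_le) (simp add: mult.commute[of L] mult_left_mono)
  qed (use assms in auto)
  then show ?thesis by simp
qed

lemma lipschitz_y:
  assumes "x < r" "y \<in> {a..b}" "y' \<in> {a..b}" "\<And>y. y \<in> {a..b} \<Longrightarrow> norm (uy x y) \<le> L"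
  shows "norm (u x y - u x y') \<le> L * \<bar>y - y'\<bar>"
proof -
  have "norm (u x y - u x y') \<le> L * norm (y - y')"
  proof (rule differentiable_bound[of "{a..b}" _ "\<lambda>y h. h *\<^sub>R uy x y"])
    fix y assume y: "y \<in> {a..b}"
    then show "((\<lambda>y. u x y) has_derivative (\<lambda>h. h *\<^sub>R uy x y)) (at y within {a..b})"
      using has_uy[of x y] assms(1) has_derivative_at_withinI unfolding has_vector_derivative_def by fastforce
    show "onorm (\<lambda>h. h *\<^sub>R uy x y) \<le> L"
      using assms(4)[OF y] by (intro onorm_le) (simp add: mult.commute[of L] mult_left_mono)
  qed (use assms in auto)
  then show ?thesis by simp
qed

text \<open>
  As \<open>u\<close> is only \<open>C\<^sup>1\<close>, the derivative of \<open>flux\<close> cannot be taken under the integral sign. Integration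
  by parts in \<open>y\<close> expresses an increment of \<open>flux\<close> through increments of \<open>u\<close>, up to this remainder.
\<close>

lemma integral_remainder_deriv:
  assumes x: "x < r"
  shows "((\<lambda>t. integral {0..2 * pi} (\<lambda>y. inner (u t y - u x y) (J (uy t y - uy x y))))
           has_real_derivative 0) (at x)"
proof -
  obtain e where e: "e > 0" "x + e < r" using x that[of "(r - x) / 2"] by (simp add: field_simps)
  obtain L where L: "L > 0" "\<And>t y. t \<in> {x-e..x+e} \<Longrightarrow> y \<in> {0..2 * pi} \<Longrightarrow> norm (ux t y) \<le> L"
    using strip_bounded[OF cont_ux e(2)] by metis
  let ?p = "\<lambda>t. integral {0..2 * pi} (\<lambda>y. inner (u t y - u x y) (J (uy t y - uy x y)))"
  let ?\<omega> = "\<lambda>t. integral {0..2 * pi} (\<lambda>y. norm (uy t y - uy x y))"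
  have "continuous_on {..<r} (\<lambda>t. integral (cbox 0 (2 * pi)) (\<lambda>y. norm (uy t y - uy x y)))"
    using x by (intro integral_continuous_on_param) (auto simp: split_beta intro!: continuous_intros)
  then have "isCont ?\<omega> x" using x by (simp add: continuous_on_eq_continuous_at)
  then have lim: "(\<lambda>t. L * ?\<omega> t) \<midarrow>x\<rightarrow> 0"
    using tendsto_mult_right_zero unfolding isCont_def by fastforce
  \<comment> \<open>The first factor is Lipschitz in \<open>t\<close>, which cancels the
    denominator; what remains is the mean oscillation of \<open>uy\<close>, which tends to 0 by
    continuity.\<close>
  have "\<forall>\<^sub>F t in at x. norm ((?p t - ?p x) / (t - x)) \<le> L * ?\<omega> t"
  proof -
    have "\<forall>\<^sub>F t in at x. t \<in> {x-e<..<x+e}"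
      using e by (intro eventually_at_in_open') auto
    moreover have "\<forall>\<^sub>F t in at x. t \<noteq> x" by (rule eventually_neq_at_within)
    ultimately show ?thesis
    proof eventually_elim
      case (elim t)
      have "norm (?p t) \<le> integral {0..2 * pi} (\<lambda>y. L * \<bar>t - x\<bar> * norm (uy t y - uy x y))"
      proof (rule integral_norm_bound_integral)
        fix y assume y: "y \<in> {0..2 * pi}"
        have "norm (inner (u t y - u x y) (J (uy t y - uy x y))) \<le> norm (u t y - u x y) * norm (uy t y - uy x y)"
          using Cauchy_Schwarz_ineq2[of "u t y - u x y" "J (uy t y - uy x y)"] J_norm by simp
        also have "\<dots> \<le> L * \<bar>t - x\<bar> * norm (uy t y - uy x y)"
          using lipschitz_x[of "x+e" t "x-e" x y L] e elim L y by (intro mult_right_mono) auto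
        finally show "norm (inner (u t y - u x y) (J (uy t y - uy x y))) \<le> L * \<bar>t - x\<bar> * norm (uy t y - uy x y)" .
      qed (use elim e x in \<open>auto intro!: integrable_continuous_real continuous_intros\<close>)
      also have "\<dots> = L * \<bar>t - x\<bar> * ?\<omega> t" by simp
      finally show ?case using elim by (simp add: field_simps)
    qed
  qed
  then have "((\<lambda>t. (?p t - ?p x) / (t - x)) \<longlongrightarrow> 0) (at x)"
    using lim by (rule Lim_null_comparison)
  then show ?thesis by (simp add: has_field_derivative_iff)
qed

text \<open>Polarization of a symmetric form B: the value B(t,t) equals B(x,x) + B(t-x,t-x) + 2
  (B(t,x) - B(x,x)). Here \<open>?p\<close> is the quadratic remainder, with derivative 0, and
  \<open>?q\<close> is the form with its second argument frozen, which can be differentiated under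
  the integral.\<close>

lemma flux_deriv:
  assumes x: "x < r"
  shows "(flux has_real_derivative 2 * integral {0..2 * pi} (\<lambda>y. inner (ux x y) (J (uy x y)))) (at x)"
proof -
  let ?p = "\<lambda>t. integral {0..2 * pi} (\<lambda>y. inner (u t y - u x y) (J (uy t y - uy x y)))"
  let ?q = "\<lambda>t. integral {0..2 * pi} (\<lambda>y. inner (u t y) (J (uy x y)))"
  have g_eq: "flux t = flux x + ?p t + 2 * (?q t - ?q x)" if t: "t < r" for t
  proof -
    have "((\<lambda>y. inner (u t y) (J (uy x y)) + inner (uy t y) (J (u x y))) has_integral
        inner (u t (2 * pi)) (J (u x (2 * pi))) - inner (u t 0) (J (u x 0))) {0..2 * pi}"
    proof (rule fundamental_theorem_of_calculus)
      fix y
      have "((\<lambda>y. u t y) has_derivative (\<lambda>h. h *\<^sub>R uy t y)) (at y)"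
        using has_uy[OF t] unfolding has_vector_derivative_def .
      moreover have "((\<lambda>y. J (u x y)) has_derivative (\<lambda>h. h *\<^sub>R J (uy x y))) (at y)"
        using bounded_linear.has_vector_derivative[OF _ has_uy[OF x], of J] J_linear
        unfolding has_vector_derivative_def by (simp add: linear_linear)
      ultimately have "((\<lambda>y. inner (u t y) (J (u x y))) has_vector_derivative
          inner (u t y) (J (uy x y)) + inner (uy t y) (J (u x y))) (at y)"
        unfolding has_vector_derivative_def
        by (rule has_derivative_eq_rhs[OF has_derivative_inner]) (simp add: algebra_simps)
      then show "((\<lambda>y. inner (u t y) (J (u x y))) has_vector_derivative
          inner (u t y) (J (uy x y)) + inner (uy t y) (J (u x y))) (at y within {0..2 * pi})"
        by (rule has_vector_derivative_at_within)
    qed simp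
    \<comment> \<open>This is the symmetry of the form: periodicity removes the boundary term of the
      integration by parts.\<close>
    then have 0: "integral {0..2 * pi} (\<lambda>y. inner (u t y) (J (uy x y)) + inner (uy t y) (J (u x y))) = 0"
      using periodic[of _ 0] by (simp add: integral_unique)
    have ints: "(\<lambda>y. inner (u t y) (J (uy t y))) integrable_on {0..2 * pi}"
      "(\<lambda>y. inner (u x y) (J (uy x y))) integrable_on {0..2 * pi}"
      "(\<lambda>y. inner (u t y) (J (uy x y))) integrable_on {0..2 * pi}"
      "(\<lambda>y. inner (u t y - u x y) (J (uy t y - uy x y))) integrable_on {0..2 * pi}"
      using t x by (intro integrable_continuous_real continuous_intros; simp)+
    have int: "(\<lambda>y. 2 * f y :: real) integrable_on {0..2 * pi}" if "f integrable_on {0..2 * pi}" for f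
      using integrable_on_cmult_left[OF that, of 2] by simp
    have "flux t - flux x - ?p t - 2 * (?q t - ?q x) = integral {0..2 * pi} (\<lambda>y.
       inner (u t y) (J (uy t y)) - inner (u x y) (J (uy x y)) - inner (u t y - u x y) (J (uy t y - uy x y))
       - 2 * (inner (u t y) (J (uy x y)) - inner (u x y) (J (uy x y))))"
      unfolding flux_def
      by (simp only: integral_diff integral_mult_right int ints integrable_diff)
    also have "\<dots> = integral {0..2 * pi} (\<lambda>y. - (inner (u t y) (J (uy x y)) + inner (uy t y) (J (u x y))))"
    proof (rule integral_cong)
      fix y
      have "inner (u x y) (J (uy t y)) = - inner (uy t y) (J (u x y))"
        using J_skew[of "uy t y" "u x y"] by (simp add: inner_commute)
      then show "inner (u t y) (J (uy t y)) - inner (u x y) (J (uy x y)) - inner (u t y - u x y) (J (uy t y - uy x y))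
       - 2 * (inner (u t y) (J (uy x y)) - inner (u x y) (J (uy x y)))
       = - (inner (u t y) (J (uy x y)) + inner (uy t y) (J (u x y)))"
        by (simp add: linear_diff[OF J_linear] inner_diff)
    qed
    also have "\<dots> = 0" using 0 by (simp only: integral_neg)
    finally show ?thesis by linarith
  qed
  have "(?q has_real_derivative integral {0..2 * pi} (\<lambda>y. inner (ux x y) (J (uy x y)))) (at x)"
    using x by (intro integral_inner_deriv continuous_intros) auto
  with integral_remainder_deriv[OF x]
  have "((\<lambda>t. flux x + ?p t + 2 * (?q t - ?q x)) has_real_derivative
     0 + 0 + 2 * (integral {0..2 * pi} (\<lambda>y. inner (ux x y) (J (uy x y))) - 0)) (at x)"
    by (intro DERIV_add DERIV_diff DERIV_cmult DERIV_const)
  then have "((\<lambda>t. flux x + ?p t + 2 * (?q t - ?q x)) has_real_derivative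
     2 * integral {0..2 * pi} (\<lambda>y. inner (ux x y) (J (uy x y)))) (at x)"
    by simp
  then show ?thesis
  proof (rule has_field_derivative_transform_within_open[of _ _ _ "{..<r}"])
    show "flux x + ?p t + 2 * (?q t - ?q x) = flux t" if "t \<in> {..<r}" for t
      using g_eq that by force
  qed (use x in auto)
qed

lemma mass_deriv:
  assumes x: "x < r"
  shows "(mass has_real_derivative 2 * integral {0..2 * pi} (\<lambda>y. inner (u x y) (ux x y))) (at x)"
proof -
  have "((\<lambda>t. integral (cbox 0 (2 * pi)) (\<lambda>y. inner (u t y) (u t y))) has_vector_derivative
           integral (cbox 0 (2 * pi)) (\<lambda>y. 2 * inner (u x y) (ux x y))) (at x within {..<r})"
  proof (rule leibniz_rule_vector_derivative)
    fix t y :: real assume "t \<in> {..<r}"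
    then have "((\<lambda>x. u x y) has_derivative (\<lambda>h. h *\<^sub>R ux t y)) (at t within {..<r})"
      using has_vector_derivative_at_within[OF has_ux[of t y]] by (simp add: has_vector_derivative_def)
    from has_derivative_inner[OF this this]
    show "((\<lambda>x. inner (u x y) (u x y)) has_vector_derivative 2 * inner (u t y) (ux t y)) (at t within {..<r})"
      unfolding has_vector_derivative_def
      by (rule has_derivative_eq_rhs) (simp add: inner_commute fun_eq_iff)
  next
    fix t assume "t \<in> {..<r}"
    then show "(\<lambda>y. inner (u t y) (u t y)) integrable_on cbox 0 (2 * pi)"
      by (intro integrable_continuous) (auto intro!: continuous_intros)
  next
    show "continuous_on ({..<r} \<times> cbox 0 (2 * pi)) (\<lambda>(t, y). 2 * inner (u t y) (ux t y))"
      by (auto simp: split_beta intro!: continuous_intros)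
  qed (use x in auto)
  moreover have "at x within {..<r} = at x"
    using x by (intro at_within_open) auto
  ultimately have "((\<lambda>t. mass t) has_real_derivative integral (cbox 0 (2 * pi)) (\<lambda>y. 2 * inner (u x y) (ux x y))) (at x)"
    by (simp only: has_real_derivative_iff_has_vector_derivative mass_def cbox_interval)
  also have "integral (cbox 0 (2 * pi)) (\<lambda>y. 2 * inner (u x y) (ux x y)) = 2 * integral {0..2 * pi} (\<lambda>y. inner (u x y) (ux x y))"
    by (simp only: integral_mult_right cbox_interval)
  finally show ?thesis .
qed

text \<open>Integrates \<open>dbar_weight_ineq\<close> over a circle with
  \<open>k = K * sqrt (norm u)\<close>. Squaring turns the square root into a factor
  \<open>norm u\<close>, hence into the small number \<open>\<delta>\<close> on the right.\<close>

lemma flux_balance_le: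
  assumes x: "x < r" and \<delta>: "\<And>y. y \<in> {0..2 * pi} \<Longrightarrow> norm (u x y) \<le> \<delta>" and small: "2 * K\<^sup>2 * \<delta> \<le> 1"
  shows "integral {0..2 * pi} (\<lambda>y. inner (ux x y) (J (uy x y))) + p * flux x
           - p * integral {0..2 * pi} (\<lambda>y. inner (u x y) (ux x y)) - p\<^sup>2 * mass x
         \<le> 2 * K\<^sup>2 * \<delta> * p\<^sup>2 * mass x"
proof -
  have ints: "(\<lambda>y. inner (ux x y) (J (uy x y))) integrable_on {0..2 * pi}"
    "(\<lambda>y. inner (u x y) (J (uy x y))) integrable_on {0..2 * pi}"
    "(\<lambda>y. inner (u x y) (ux x y)) integrable_on {0..2 * pi}"
    "(\<lambda>y. inner (u x y) (u x y)) integrable_on {0..2 * pi}"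
    using x by (intro integrable_continuous_real continuous_intros; simp)+
  have int: "(\<lambda>y. c * f y :: real) integrable_on {0..2 * pi}" if "f integrable_on {0..2 * pi}" for f c
    using integrable_on_cmult_left[OF that, of c] by simp
  have "integral {0..2 * pi} (\<lambda>y. inner (ux x y) (J (uy x y)) + p * inner (u x y) (J (uy x y))
           - p * inner (u x y) (ux x y) - p\<^sup>2 * inner (u x y) (u x y))
       \<le> integral {0..2 * pi} (\<lambda>y. 2 * K\<^sup>2 * \<delta> * p\<^sup>2 * inner (u x y) (u x y))"
  proof (rule integral_le)
    fix y assume y: "y \<in> {0..2 * pi}"
    let ?k = "K * sqrt (norm (u x y))"
    have k2: "?k\<^sup>2 = K\<^sup>2 * norm (u x y)" by (simp add: power_mult_distrib)
    have kd: "?k\<^sup>2 \<le> K\<^sup>2 * \<delta>" unfolding k2 using \<delta>[OF y] by (intro mult_left_mono) auto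
    have "inner (ux x y) (J (uy x y)) + p * inner (u x y) (J (uy x y))
           - p * inner (u x y) (ux x y) - p\<^sup>2 * inner (u x y) (u x y)
        \<le> 2 * ?k\<^sup>2 * p\<^sup>2 * inner (u x y) (u x y)"
      using dbar_weight_ineq[OF dbar_le[OF x]] kd small by simp
    also have "\<dots> \<le> 2 * (K\<^sup>2 * \<delta>) * p\<^sup>2 * inner (u x y) (u x y)"
      using kd by (intro mult_right_mono mult_left_mono) auto
    finally show "inner (ux x y) (J (uy x y)) + p * inner (u x y) (J (uy x y))
           - p * inner (u x y) (ux x y) - p\<^sup>2 * inner (u x y) (u x y)
        \<le> 2 * K\<^sup>2 * \<delta> * p\<^sup>2 * inner (u x y) (u x y)" by (simp add: mult.assoc)
  qed (intro integrable_add integrable_diff int ints)+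
  then show ?thesis
    unfolding mass_def flux_def
    by (simp only: integral_diff integral_add integral_mult_right int ints integrable_diff integrable_add)
qed

section \<open>Weighted energy and exponential decay\<close>

text \<open>
  Write \<open>\<phi> x = \<tau> * (x\<^sup>2 / (4 * s) - x)\<close> for the weight, and \<open>p\<close>, \<open>q\<close> for the derivatives of \<open>u\<close> with
  respect to \<open>w = x + \<i> y\<close> and to its conjugate. The derivative of \<open>energy\<close> is the integral over \<open>y\<close> of
  \<open>exp (2 * \<phi>) * (\<bar>q\<bar>\<^sup>2 - \<bar>p + \<phi>' u\<bar>\<^sup>2 - \<phi>'' \<bar>u\<bar>\<^sup>2 / 2)\<close>, which is the Carleman identity before
  integration in \<open>x\<close>.
\<close>

definition energy :: "real \<Rightarrow> real \<Rightarrow> real \<Rightarrow> real" where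
  "energy \<tau> s x = exp (2 * (\<tau> * (x\<^sup>2 / (4 * s) - x))) * (flux x / 2 - \<tau> * (x / (2 * s) - 1) * mass x / 2)"

lemma energy_deriv:
  assumes x: "x < r" and s: "s > 0"
  shows "(energy \<tau> s has_real_derivative exp (2 * (\<tau> * (x\<^sup>2 / (4 * s) - x))) *
    (integral {0..2 * pi} (\<lambda>y. inner (ux x y) (J (uy x y))) + \<tau> * (x / (2 * s) - 1) * flux x
           - \<tau> * (x / (2 * s) - 1) * integral {0..2 * pi} (\<lambda>y. inner (u x y) (ux x y))
           - (\<tau> * (x / (2 * s) - 1))\<^sup>2 * mass x - \<tau> / (4 * s) * mass x)) (at x)"
proof -
  define G N E q where "G = integral {0..2 * pi} (\<lambda>y. inner (ux x y) (J (uy x y)))"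
    and "N = integral {0..2 * pi} (\<lambda>y. inner (u x y) (ux x y))"
    and "E = exp (2 * (\<tau> * (x\<^sup>2 / (4 * s) - x)))" and "q = x / (2 * s) - 1"
  have ph: "((\<lambda>x. x\<^sup>2 / (4 * s) - x) has_real_derivative q) (at x)"
    unfolding q_def using s by (auto intro!: derivative_eq_intros simp: field_simps)
  have exp: "((\<lambda>x. exp (2 * (\<tau> * (x\<^sup>2 / (4 * s) - x)))) has_real_derivative E * (2 * (\<tau> * q))) (at x)"
    unfolding E_def by (intro DERIV_cmult DERIV_fun_exp ph)
  have g: "((\<lambda>x. flux x / 2) has_real_derivative 2 * G / 2) (at x)"
    unfolding G_def by (intro DERIV_cdivide flux_deriv x)
  have q: "((\<lambda>x. \<tau> * (x / (2 * s) - 1)) has_real_derivative \<tau> * (1 / (2 * s) - 0)) (at x)"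
    by (intro DERIV_cmult DERIV_diff DERIV_cdivide DERIV_ident DERIV_const)
  have n: "((\<lambda>x. \<tau> * (x / (2 * s) - 1) * mass x / 2) has_real_derivative
      (\<tau> * (1 / (2 * s) - 0) * mass x + 2 * N * (\<tau> * q)) / 2) (at x)"
    unfolding q_def N_def by (intro DERIV_cdivide DERIV_mult q mass_deriv x)
  have "(energy \<tau> s has_real_derivative
      E * (2 * (\<tau> * q)) * (flux x / 2 - \<tau> * q * mass x / 2)
      + (2 * G / 2 - (\<tau> * (1 / (2 * s) - 0) * mass x + 2 * N * (\<tau> * q)) / 2) * E) (at x)"
    unfolding energy_def[abs_def] using DERIV_mult[OF exp DERIV_diff[OF g n]] by (simp only: E_def q_def)
  also have "E * (2 * (\<tau> * q)) * (flux x / 2 - \<tau> * q * mass x / 2)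
      + (2 * G / 2 - (\<tau> * (1 / (2 * s) - 0) * mass x + 2 * N * (\<tau> * q)) / 2) * E
      = E * (G + \<tau> * q * flux x - \<tau> * q * N - (\<tau> * q)\<^sup>2 * mass x - \<tau> / (4 * s) * mass x)"
    using s by (simp add: field_simps power2_eq_square)
  finally show ?thesis by (simp only: G_def N_def E_def q_def)
qed

lemma mass_lower:
  assumes x: "x < r" and h: "h \<ge> 0" "{c..c+h} \<subseteq> {0..2 * pi}" and \<mu>: "\<mu> \<ge> 0" "\<And>y. y \<in> {c..c+h} \<Longrightarrow> norm (u x y) \<ge> \<mu>"
  shows "mass x \<ge> h * \<mu>\<^sup>2"
proof -
  have int: "(\<lambda>y. inner (u x y) (u x y)) integrable_on {a..b}" for a b
    using x by (intro integrable_continuous_real continuous_intros) auto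
  have "h * \<mu>\<^sup>2 = integral {c..c+h} (\<lambda>y. \<mu>\<^sup>2)" using h by simp
  also have "\<dots> \<le> integral {c..c+h} (\<lambda>y. inner (u x y) (u x y))"
  proof (intro integral_le int integrable_const_ivl)
    show "\<mu>\<^sup>2 \<le> inner (u x y) (u x y)" if "y \<in> {c..c+h}" for y
      using \<mu>(2)[OF that] \<mu>(1) by (simp flip: power2_norm_eq_inner add: power_mono)
  qed
  also have "\<dots> \<le> mass x"
    unfolding mass_def using h by (intro integral_subset_le int) auto
  finally show ?thesis .
qed

lemma mass_nonneg: "x < r \<Longrightarrow> mass x \<ge> 0"
  using mass_lower[of x 0 0 0] by auto

lemma flux_bound:
  assumes x: "x < r" and "\<And>y. y \<in> {0..2 * pi} \<Longrightarrow> norm (u x y) \<le> \<delta>"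
    "\<And>y. y \<in> {0..2 * pi} \<Longrightarrow> norm (uy x y) \<le> L"
  shows "\<bar>flux x\<bar> \<le> 2 * pi * \<delta> * L"
proof -
  have "norm (integral {0..2 * pi} (\<lambda>y. inner (u x y) (J (uy x y)))) \<le> (\<delta> * L) * (2 * pi - 0)"
  proof (rule integral_bound)
    show "continuous_on {0..2 * pi} (\<lambda>y. inner (u x y) (J (uy x y)))"
      using x by (intro continuous_intros) auto
    fix y :: real assume y: "y \<in> {0..2 * pi}"
    have "norm (inner (u x y) (J (uy x y))) \<le> norm (u x y) * norm (uy x y)"
      using Cauchy_Schwarz_ineq2[of "u x y" "J (uy x y)"] J_norm by simp
    also have "\<dots> \<le> \<delta> * L" using assms y norm_ge_zero order_trans by (intro mult_mono) blast+
    finally show "norm (inner (u x y) (J (uy x y))) \<le> \<delta> * L" .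
  qed simp
  then show ?thesis by (simp add: flux_def algebra_simps)
qed

text \<open>The energy starts at 0, never increases on \<open>{0..b}\<close>, and drops near
  \<open>x0\<close> by an amount controlled from below by \<open>norm (u x0 y0)\<close>. Its size at
  \<open>b\<close> is controlled from above by the flux. Comparing the weights at \<open>a\<close>
  and \<open>b\<close> gives the exponential. The fourth power consists of two from the mass density
  and one from each side of a box of side proportional to \<open>norm (u x0 y0)\<close>.\<close>

lemma decay:
  assumes ab: "0 < a" "a < b" "b \<le> s" "s < r" "s \<le> 1"
    and \<delta>: "\<And>x y. x \<in> {0..b} \<Longrightarrow> y \<in> {0..2 * pi} \<Longrightarrow> norm (u x y) \<le> \<delta>" "\<delta> > 0" "2 * K\<^sup>2 * \<delta> \<le> 1"
    and L: "L > 0" "\<And>x y. x \<in> {0..s} \<Longrightarrow> y \<in> {0..2 * pi} \<Longrightarrow> norm (ux x y) \<le> L"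
       "\<And>x y. x \<in> {0..s} \<Longrightarrow> y \<in> {0..2 * pi} \<Longrightarrow> norm (uy x y) \<le> L"
    and xy: "x0 \<in> {0..a}" "y0 \<in> {0..2 * pi}"
  shows "(norm (u x0 y0)) ^ 4 \<le> 8192 * pi * L^3 * K\<^sup>2 * \<delta>\<^sup>2 * s\<^sup>2 * exp (- ((b - a) / (16 * K\<^sup>2 * \<delta> * s)))"
proof (cases "u x0 y0 = 0")
  case True
  then show ?thesis using L(1) by simp
next
  case False
  define m where "m = norm (u x0 y0)"
  have m: "m > 0" using False by (simp add: m_def)
  have s: "s > 0" using ab by simp
  have lipx: "norm (u x y - u x' y) \<le> L * \<bar>x - x'\<bar>" if "x \<in> {0..s}" "x' \<in> {0..s}" "y \<in> {0..2 * pi}" for x x' y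
    using lipschitz_x[of s x 0 x' y L] that L(2) ab by auto
  have lipy: "norm (u x y - u x y') \<le> L * \<bar>y - y'\<bar>" if "x \<in> {0..s}" "y \<in> {0..2 * pi}" "y' \<in> {0..2 * pi}" for x y y'
    using lipschitz_y[of x y 0 "2 * pi" y' L] that L(3) ab by auto
  \<comment> \<open>Over a distance \<open>h\<close> in either direction \<open>u\<close> changes by
    at most \<open>m / 4\<close>, so its norm stays at least \<open>m / 2\<close> on a box of side
    \<open>h\<close>. As \<open>u\<close> vanishes at \<open>x = 0\<close>, the box lies in positive
    \<open>x\<close>.\<close>
  define h where "h = m / (4 * L)"
  have mL: "m \<le> L * x0"
    using lipx[of x0 0 y0] xy ab zero[of 0 y0] by (simp add: m_def)
  have h: "h > 0" "4 * h \<le> x0" using m L(1) mL by (simp_all add: h_def field_simps)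
  have Lh: "L * h = m / 4" using L(1) by (simp add: h_def)
  have h1: "h \<le> 1" using h xy ab by auto
  \<comment> \<open>The angular window extends to whichever side of \<open>y0\<close> keeps it
    within one period.\<close>
  define c where "c = (if y0 \<le> pi then y0 else y0 - h)"
  have c: "{c..c+h} \<subseteq> {0..2 * pi}" "y0 \<in> {c..c+h}"
    using h h1 xy pi_gt3 by (auto simp: c_def)
  have low: "m / 2 \<le> norm (u x y)" if "x \<in> {x0-h..x0}" "y \<in> {c..c+h}" for x y
  proof -
    have "norm (u x0 y0 - u x y0) \<le> L * \<bar>x0 - x\<bar>" using that xy ab h by (intro lipx) auto
    also have "\<dots> \<le> L * h" using that L by (intro mult_left_mono) auto
    finally have 1: "norm (u x0 y0 - u x y0) \<le> m / 4" using Lh by simp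
    have "norm (u x y0 - u x y) \<le> L * \<bar>y0 - y\<bar>"
      using that(1) xy ab h subsetD[OF c(1) that(2)] by (intro lipy) auto
    also have "\<dots> \<le> L * h" using that c(2) L by (intro mult_left_mono) auto
    finally have 2: "norm (u x y0 - u x y) \<le> m / 4" using Lh by simp
    have "m \<le> norm (u x0 y0 - u x y0) + norm (u x y0 - u x y) + norm (u x y)"
      unfolding m_def by (smt (verit) norm_triangle_sub)
    then show ?thesis using 1 2 by simp
  qed
  have mass_low: "mass x \<ge> h * (m / 2)\<^sup>2" if "x \<in> {x0-h..x0}" for x
    using that low[OF that] xy ab h c(1) m by (intro mass_lower) auto
  \<comment> \<open>Chosen so that the error
    \<open>2 * K\<^sup>2 * \<delta> * \<tau>\<^sup>2\<close> is exactly half of the convexity gain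
    \<open>\<tau> / (4 * s)\<close>.\<close>
  define \<tau> where "\<tau> = 1 / (16 * K\<^sup>2 * \<delta> * s)"
  have \<tau>: "\<tau> > 0" using K_pos \<delta>(2) s by (simp add: \<tau>_def)
  define ph where "ph x = \<tau> * (x\<^sup>2 / (4 * s) - x)" for x
  have K\<delta>: "2 * K\<^sup>2 * \<delta> * \<tau>\<^sup>2 = \<tau> / (8 * s)"
    using K_pos \<delta>(2) s by (simp add: \<tau>_def field_simps power2_eq_square)
  \<comment> \<open>On \<open>{0..s}\<close> the slope of the weight runs from
    \<open>- \<tau>\<close> to \<open>- \<tau> / 2\<close>.\<close>
  have ph_le: "ph y - ph x \<le> - (\<tau> / 2) * (y - x)" if "0 \<le> x" "x \<le> y" "y \<le> s" for x y
  proof -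
    have "(x + y) / (4 * s) \<le> 1 / 2" using that s by (simp add: field_simps)
    then have "(x + y) / (4 * s) - 1 \<le> - 1 / 2" by linarith
    then have "\<tau> * (y - x) * ((x + y) / (4 * s) - 1) \<le> \<tau> * (y - x) * (- 1 / 2)"
      using \<tau> that by (intro mult_left_mono) auto
    moreover have "ph y - ph x = \<tau> * (y - x) * ((x + y) / (4 * s) - 1)"
      using s by (simp add: ph_def field_simps power2_eq_square)
    ultimately show ?thesis by simp
  qed
  have energy_decr: "\<exists>D. (energy \<tau> s has_real_derivative D) (at x) \<and> D \<le> - (\<tau> / (8 * s)) * exp (2 * ph x) * mass x"
    if x: "x \<in> {0..b}" for x
  proof -
    define p where "p = \<tau> * (x / (2 * s) - 1)"
    have "\<bar>x / (2 * s) - 1\<bar> \<le> 1" using x s ab by (auto simp: abs_le_iff field_simps)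
    \<comment> \<open>The slope never exceeds \<open>\<tau>\<close> in size, so the error stays
      below half of the gain and the other half makes the energy decrease.\<close>
    then have "p\<^sup>2 \<le> \<tau>\<^sup>2" using \<tau>
      by (simp add: p_def power_mult_distrib mult_left_le abs_square_le_1)
    then have "2 * K\<^sup>2 * \<delta> * p\<^sup>2 * mass x \<le> 2 * K\<^sup>2 * \<delta> * \<tau>\<^sup>2 * mass x"
      using \<delta>(2) mass_nonneg[of x] x ab by (intro mult_left_mono mult_right_mono) auto
    then have 1: "2 * K\<^sup>2 * \<delta> * p\<^sup>2 * mass x \<le> \<tau> / (8 * s) * mass x" unfolding K\<delta> .
    let ?E = "integral {0..2 * pi} (\<lambda>y. inner (ux x y) (J (uy x y))) + p * flux x
           - p * integral {0..2 * pi} (\<lambda>y. inner (u x y) (ux x y)) - p\<^sup>2 * mass x"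
    have "?E \<le> 2 * K\<^sup>2 * \<delta> * p\<^sup>2 * mass x"
      using x ab \<delta> by (intro flux_balance_le) auto
    with 1 have "?E - \<tau> / (4 * s) * mass x \<le> - (\<tau> / (8 * s)) * mass x"
      by (simp add: field_simps)
    from mult_left_mono[OF this, of "exp (2 * ph x)"]
    have "exp (2 * ph x) * (?E - \<tau> / (4 * s) * mass x) \<le> - (\<tau> / (8 * s)) * exp (2 * ph x) * mass x"
      by (simp add: mult_ac)
    moreover have "(energy \<tau> s has_real_derivative exp (2 * ph x) * (?E - \<tau> / (4 * s) * mass x)) (at x)"
      unfolding ph_def p_def using x ab s by (intro energy_deriv) auto
    ultimately show ?thesis by blast
  qed
  have energy_anti: "energy \<tau> s y \<le> energy \<tau> s x" if "0 \<le> x" "x \<le> y" "y \<le> b" for x y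
  proof (rule DERIV_nonpos_imp_nonincreasing[OF that(2)])
    fix t assume t: "x \<le> t" "t \<le> y"
    then obtain D where "(energy \<tau> s has_real_derivative D) (at t)" "D \<le> - (\<tau> / (8 * s)) * exp (2 * ph t) * mass t"
      using energy_decr[of t] \<open>0 \<le> x\<close> \<open>y \<le> b\<close> by auto
    moreover have "- (\<tau> / (8 * s)) * exp (2 * ph t) * mass t \<le> 0"
      using \<tau> s mass_nonneg[of t] t \<open>y \<le> b\<close> ab by simp
    ultimately show "\<exists>D. (energy \<tau> s has_real_derivative D) (at t) \<and> D \<le> 0" by force
  qed
  \<comment> \<open>A lower bound for the rate of decrease on \<open>{x0-h..x0}\<close>: the weight
    decreases, so its value at \<open>a\<close> is the smallest one to consider.\<close>
  define \<kappa> where "\<kappa> = \<tau> / (8 * s) * exp (2 * ph a) * (h * (m / 2)\<^sup>2)"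
  have "energy \<tau> s x0 - energy \<tau> s (x0 - h) \<le> - \<kappa> * h"
  proof -
    have "\<exists>z>x0-h. z < x0 \<and> (\<exists>D. energy \<tau> s x0 - energy \<tau> s (x0-h) = (x0 - (x0-h)) * D \<and> D \<le> - \<kappa>)"
    proof -
      have "\<forall>x\<in>{0..b}. \<exists>D. (energy \<tau> s has_real_derivative D) (at x) \<and> D \<le> - (\<tau> / (8 * s)) * exp (2 * ph x) * mass x"
        using energy_decr by blast
      then obtain D where D: "\<And>x. x \<in> {0..b} \<Longrightarrow> (energy \<tau> s has_real_derivative D x) (at x)"
          "\<And>x. x \<in> {0..b} \<Longrightarrow> D x \<le> - (\<tau> / (8 * s)) * exp (2 * ph x) * mass x"
        by metis
      obtain z where z: "x0-h < z" "z < x0" "energy \<tau> s x0 - energy \<tau> s (x0-h) = (x0 - (x0-h)) * D z"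
        using MVT2[of "x0-h" x0 "energy \<tau> s" D] h xy ab D(1) by auto
      have z_in: "z \<in> {0..b}" "z \<le> a" "0 \<le> z" using z h xy ab by auto
      have "ph a \<le> ph z" using ph_le[of z a] z_in ab \<tau>
        by (smt (verit, ccfv_SIG) divide_pos_pos mult_minus_left mult_nonneg_nonneg)
      then have "\<kappa> \<le> \<tau> / (8 * s) * exp (2 * ph z) * mass z"
        unfolding \<kappa>_def using mass_low[of z] z h m \<tau> s mass_nonneg[of z] z_in ab by (intro mult_mono) auto
      with D(2)[OF z_in(1)] show ?thesis using z by fastforce
    qed
    then obtain D where "energy \<tau> s x0 - energy \<tau> s (x0-h) = h * D" "D \<le> - \<kappa>" by auto
    then show ?thesis using mult_left_mono[of D "- \<kappa>" h] h(1) by (simp add: mult.commute)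
  qed
  moreover have "energy \<tau> s 0 = 0" by (simp add: energy_def flux_def mass_def zero)
  moreover have "energy \<tau> s (x0 - h) \<le> energy \<tau> s 0" using h xy ab by (intro energy_anti) auto
  moreover have "energy \<tau> s b \<le> energy \<tau> s x0" using h xy ab by (intro energy_anti) auto
  ultimately have lower: "\<kappa> * h \<le> - energy \<tau> s b" by simp
  have "- energy \<tau> s b \<le> exp (2 * ph b) * (pi * \<delta> * L)"
  proof -
    \<comment> \<open>The slope at \<open>b\<close> is negative, so the mass term has the favourable
      sign and only the flux has to be estimated.\<close>
    have "\<tau> * (b / (2 * s) - 1) \<le> 0"
      using \<tau> s ab by (intro mult_nonneg_nonpos) (auto simp: field_simps)
    then have "\<tau> * (b / (2 * s) - 1) * mass b / 2 \<le> 0"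
      using mass_nonneg[of b] ab by (simp add: mult_nonpos_nonneg)
    moreover have "\<bar>flux b\<bar> \<le> 2 * pi * \<delta> * L" using ab \<delta> L by (intro flux_bound) auto
    then have "- (flux b / 2) \<le> pi * \<delta> * L" by (simp add: abs_le_iff field_simps)
    ultimately have "- (flux b / 2 - \<tau> * (b / (2 * s) - 1) * mass b / 2) \<le> pi * \<delta> * L" by linarith
    then have "exp (2 * ph b) * - (flux b / 2 - \<tau> * (b / (2 * s) - 1) * mass b / 2) \<le> exp (2 * ph b) * (pi * \<delta> * L)"
      by (rule mult_left_mono) simp
    then show ?thesis by (simp only: energy_def ph_def mult_minus_right)
  qed
  with lower have "\<kappa> * h \<le> exp (2 * ph b) * (pi * \<delta> * L)" by simp
  then have "m ^ 4 * exp (2 * ph a) \<le> 512 * s * L\<^sup>2 / \<tau> * (exp (2 * ph b) * (pi * \<delta> * L))"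
    using L(1) \<tau> s by (simp add: \<kappa>_def h_def field_simps power2_eq_square power4_eq_xxxx)
  then have "m ^ 4 \<le> 512 * s * L\<^sup>2 / \<tau> * (exp (2 * ph b) * (pi * \<delta> * L)) / exp (2 * ph a)"
    by (simp only: pos_le_divide_eq[OF exp_gt_zero])
  also have "\<dots> = 512 * s * L\<^sup>2 / \<tau> * (pi * \<delta> * L) * (exp (2 * ph b) / exp (2 * ph a))"
    using \<tau> by (simp add: field_simps)
  also have "exp (2 * ph b) / exp (2 * ph a) = exp (2 * (ph b - ph a))" by (simp add: exp_diff[symmetric] algebra_simps)
  also have "512 * s * L\<^sup>2 / \<tau> * (pi * \<delta> * L) * exp (2 * (ph b - ph a)) \<le> 512 * s * L\<^sup>2 / \<tau> * (pi * \<delta> * L) * exp (- \<tau> * (b - a))"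
    using ph_le[of a b] ab L(1) \<tau> s \<delta>(2) by (intro mult_left_mono) auto
  also have "512 * s * L\<^sup>2 / \<tau> * (pi * \<delta> * L) = 8192 * pi * L^3 * K\<^sup>2 * \<delta>\<^sup>2 * s\<^sup>2"
    using K_pos \<delta>(2) s by (simp add: \<tau>_def field_simps power2_eq_square power3_eq_cube)
  finally show ?thesis by (simp add: m_def \<tau>_def)
qed

section \<open>Iteration of the decay estimate\<close>

text \<open>Any positive gain suffices, so \<open>s\<close> may be tiny in terms of \<open>K\<close>
  and the bound \<open>L\<close> on the derivatives; a supremum argument later reaches the largest
  disc.\<close>

lemma vanishes_beyond_zero:
  obtains s where "s > 0" "s < r" "\<And>x y. x \<in> {0..s} \<Longrightarrow> y \<in> {0..2 * pi} \<Longrightarrow> u x y = 0"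
proof -
  define s0 where "s0 = min 1 (r / 2)"
  have s0: "s0 > 0" "s0 < r" "s0 \<le> 1" using r_pos by (auto simp: s0_def)
  obtain L1 where L1: "L1 > 0" "\<And>x y. x \<in> {0..s0} \<Longrightarrow> y \<in> {0..2 * pi} \<Longrightarrow> norm (ux x y) \<le> L1"
    using strip_bounded[OF cont_ux s0(2)] by metis
  obtain L2 where L2: "L2 > 0" "\<And>x y. x \<in> {0..s0} \<Longrightarrow> y \<in> {0..2 * pi} \<Longrightarrow> norm (uy x y) \<le> L2"
    using strip_bounded[OF cont_uy s0(2)] by metis
  define L where "L = max L1 L2"
  have L: "L > 0" "\<And>x y. x \<in> {0..s0} \<Longrightarrow> y \<in> {0..2 * pi} \<Longrightarrow> norm (ux x y) \<le> L"
      "\<And>x y. x \<in> {0..s0} \<Longrightarrow> y \<in> {0..2 * pi} \<Longrightarrow> norm (uy x y) \<le> L"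
    using L1 L2 by (force simp: L_def)+
  \<comment> \<open>Collects the constants of one iteration step: one factor 256 is from
    \<open>exp_minus_le_power4\<close>, the other is \<open>4 ^ 4\<close> from the targeted gain,
    and \<open>64 ^ 4\<close> is from the denominator of \<open>t\<close>.\<close>
  define D where "D = 8192 * pi * 256\<^sup>2 * 64 ^ 4 * L ^ 5 * K ^ 10"
  have D: "D > 0" using L K_pos by (simp add: D_def)
  \<comment> \<open>The first bound gives the smallness required by \<open>decay\<close> for the
    initial size \<open>L * s\<close>; the second makes the constant \<open>D * s ^ 4\<close> of the
    iteration at most 1.\<close>
  define s where "s = min s0 (min (1 / (2 * K\<^sup>2 * L)) (1 / D))"
  have "s \<le> 1 / (2 * K\<^sup>2 * L)" "s \<le> 1 / D" by (simp_all add: s_def)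
  then have s: "s > 0" "s \<le> s0" "s \<le> 1" "s < r" "2 * K\<^sup>2 * (L * s) \<le> 1" "D * s \<le> 1"
    using s0 L D K_pos by (simp_all add: s_def field_simps)
  have "s ^ 4 \<le> s" using s power_decreasing[of 1 4 s] by simp
  then have "D * s ^ 4 \<le> D * s" using D by simp
  with s(6) have Ds: "D * s ^ 4 \<le> 1" by simp
  define \<kappa> where "\<kappa> = L * s"
  have \<kappa>: "\<kappa> > 0" using L s by (simp add: \<kappa>_def)
  \<comment> \<open>The bound improves by a factor \<open>4\<close> while the strip shrinks only by \<open>s / 2 ^ (j + 2)\<close>, so the
    exponent supplied by \<open>decay\<close> doubles at each step.\<close>
  have main: "norm (u x y) \<le> \<kappa> / 4 ^ j" if "x \<in> {0..s / 2 + s / 2 / 2 ^ j}" "y \<in> {0..2 * pi}" for j x y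
    using that
  proof (induction j arbitrary: x y)
    case 0
    then have x: "x \<in> {0..s}" by simp
    have "norm (u x y - u 0 y) \<le> L * \<bar>x - 0\<bar>"
      using x 0 s by (intro lipschitz_x[of s _ 0] L) auto
    also have "\<dots> \<le> L * s" using x L by (intro mult_left_mono) auto
    finally show ?case by (simp add: zero \<kappa>_def)
  next
    case (Suc j)
    define a b where "a = s / 2 + s / 2 / 2 ^ Suc j" and "b = s / 2 + s / 2 / 2 ^ j"
    have "s / 2 / 2 ^ j \<le> s / 2 / 1" using s(1) by (intro divide_left_mono) auto
    then have ab: "0 < a" "a < b" "b \<le> s" using s(1) by (auto simp: a_def b_def field_simps add_pos_pos)
    have \<kappa>j: "2 * K\<^sup>2 * (\<kappa> / 4 ^ j) \<le> 1"
    proof -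
      have "\<kappa> / 4 ^ j \<le> \<kappa> / 1" using \<kappa> by (intro divide_left_mono) auto
      then have "2 * K\<^sup>2 * (\<kappa> / 4 ^ j) \<le> 2 * K\<^sup>2 * \<kappa>" by (intro mult_left_mono) auto
      also have "\<dots> \<le> 1" using s(5) by (simp add: \<kappa>_def)
      finally show ?thesis .
    qed
    define t where "t = 2 ^ j / (64 * K\<^sup>2 * \<kappa>)"
    have t: "t > 0" using K_pos \<kappa> by (simp add: t_def)
    have pow: "(4::real) ^ j = 2 ^ j * 2 ^ j" by (simp flip: power_mult_distrib)
    have "b - a = s / (4 * 2 ^ j)" by (simp add: a_def b_def field_simps)
    then have t_eq: "(b - a) / (16 * K\<^sup>2 * (\<kappa> / 4 ^ j) * s) = t"
      using s(1) \<kappa> K_pos by (simp only: t_def pow) (simp add: field_simps)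
    have "norm (u x y) ^ 4 \<le> 8192 * pi * L^3 * K\<^sup>2 * (\<kappa> / 4 ^ j)\<^sup>2 * s\<^sup>2 * exp (- ((b - a) / (16 * K\<^sup>2 * (\<kappa> / 4 ^ j) * s)))"
    proof (rule decay[OF ab s(4,3)])
      show "norm (u x y) \<le> \<kappa> / 4 ^ j" if "x \<in> {0..b}" "y \<in> {0..2 * pi}" for x y
        using Suc.IH that by (simp add: b_def)
      show "x \<in> {0..a}" using Suc.prems by (simp add: a_def)
    qed (use \<kappa>j \<kappa> L s Suc.prems in auto)
    \<comment> \<open>As \<open>t\<close> is proportional to \<open>2 ^ j\<close>, the factor
      \<open>1 / t ^ 4\<close> supplies the two powers of \<open>1 / 4 ^ j\<close> missing from
      \<open>(\<kappa> / 4 ^ j)\<^sup>2\<close> to make a fourth power.\<close>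
    also have "\<dots> \<le> 8192 * pi * L^3 * K\<^sup>2 * (\<kappa> / 4 ^ j)\<^sup>2 * s\<^sup>2 * (256 / t ^ 4)"
      unfolding t_eq using L(1) by (intro mult_left_mono exp_minus_le_power4 t) auto
    also have "\<dots> = (D * s ^ 4) * (\<kappa> / 4 ^ Suc j) ^ 4"
      using K_pos L(1) s(1)
      by (simp add: t_def D_def \<kappa>_def pow power_mult_distrib power_divide field_simps eval_nat_numeral)
    also have "\<dots> \<le> 1 * (\<kappa> / 4 ^ Suc j) ^ 4" using Ds by (intro mult_right_mono) auto
    finally show ?case using \<kappa> by (simp add: power_mono_iff del: power_Suc)
  qed
  have "u x y = 0" if xy: "x \<in> {0..s / 2}" "y \<in> {0..2 * pi}" for x y
  proof -
    have "norm (u x y) \<le> \<kappa> * (1 / 4) ^ j" for j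
    proof -
      have "x \<in> {0..s / 2 + s / 2 / 2 ^ j}"
        using xy s(1) by (auto intro: order_trans[of _ "s / 2"])
      then show ?thesis using main[of x j y] xy by (simp add: power_divide)
    qed
    moreover have "(\<lambda>j. \<kappa> * (1 / 4) ^ j) \<longlonglongrightarrow> \<kappa> * 0"
      by (intro tendsto_intros LIMSEQ_power_zero) auto
    ultimately have "norm (u x y) \<le> \<kappa> * 0"
      by (intro LIMSEQ_le_const) auto
    then show ?thesis by simp
  qed
  then show ?thesis using that[of "s / 2"] s by simp
qed

end

section \<open>Complex vectors as a real inner product space\<close>

lemma norm_vector_smult:
  fixes v :: "complex ^ 'n"
  shows "norm (c *s v) = cmod c * norm v"
  by (simp add: norm_vec_def norm_mult L2_set_right_distrib)

lemma scaleR_eq_smult: "r *\<^sub>R (v :: complex ^ 'n) = of_real r *s v"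
  by (simp add: vec_eq_iff scaleR_conv_of_real[of r "_ :: complex"])

lemma inner_i_smult:
  fixes v w :: "complex ^ 'n"
  shows "inner (\<i> *s v) w = - inner v (\<i> *s w)"
  by (simp add: inner_vec_def inner_complex_def sum_negf[symmetric])

lemma ball_in_unit_ball: "ball q (1 - norm q) \<subseteq> ball 0 1"
proof
  fix z assume "z \<in> ball q (1 - norm q)"
  then show "z \<in> ball 0 1"
    using norm_triangle_sub[of z q] by (simp add: dist_norm norm_minus_commute)
qed

section \<open>Conformal change to logarithmic polar coordinates\<close>

locale dbar_map =
  fixes u :: "complex \<Rightarrow> complex ^ 'n" and u' :: "complex \<Rightarrow> complex \<Rightarrow>\<^sub>L (complex ^ 'n)" and K :: real
  assumes u_deriv: "z \<in> ball 0 1 \<Longrightarrow> (u has_derivative blinfun_apply (u' z)) (at z)"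
    and u'_cont: "continuous_on (ball 0 1) u'"
    and K_pos: "K > 0"
    and zbar_le: "z \<in> ball 0 1 \<Longrightarrow>
           norm (partial_zbar u z) \<le> K * norm (u z) powr (1 / 2) * norm (partial_z u z)"
begin

lemma u_cont: "continuous_on (ball 0 1) u"
  using u_deriv has_derivative_continuous by (metis continuous_at_imp_continuous_on)

lemma deriv_along:
  assumes "f t \<in> ball 0 1" "(f has_vector_derivative d) (at t)"
  shows "((\<lambda>t. u (f t)) has_vector_derivative blinfun_apply (u' (f t)) d) (at t)"
  using has_derivative_compose[OF assms(2)[unfolded has_vector_derivative_def] u_deriv[OF assms(1)]]
  unfolding has_vector_derivative_def by (simp add: blinfun.scaleR_right)

lemma partial_x_eq: "z \<in> ball 0 1 \<Longrightarrow> partial_x u z = blinfun_apply (u' z) 1"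
proof -
  assume z: "z \<in> ball 0 1"
  have "((\<lambda>x. Complex x (Im z)) has_vector_derivative 1) (at (Re z))"
    unfolding Complex_eq by (auto intro!: derivative_eq_intros)
  from deriv_along[OF _ this] z show ?thesis
    unfolding partial_x_def by (intro vector_derivative_at) simp
qed

lemma partial_y_eq: "z \<in> ball 0 1 \<Longrightarrow> partial_y u z = blinfun_apply (u' z) \<i>"
proof -
  assume z: "z \<in> ball 0 1"
  have "((\<lambda>y. Complex (Re z) y) has_vector_derivative \<i>) (at (Im z))"
    unfolding Complex_eq by (auto intro!: derivative_eq_intros)
  from deriv_along[OF _ this] z show ?thesis
    unfolding partial_y_def by (intro vector_derivative_at) simp
qed

lemma deriv_eq_partials:
  assumes "z \<in> ball 0 1"
  shows "blinfun_apply (u' z) \<zeta> = of_real (Re \<zeta>) *s partial_x u z + of_real (Im \<zeta>) *s partial_y u z"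
proof -
  have "\<zeta> = Re \<zeta> *\<^sub>R 1 + Im \<zeta> *\<^sub>R \<i>" by (simp add: complex_eq_iff)
  then have "blinfun_apply (u' z) \<zeta> = Re \<zeta> *\<^sub>R blinfun_apply (u' z) 1 + Im \<zeta> *\<^sub>R blinfun_apply (u' z) \<i>"
    by (metis blinfun.add_right blinfun.scaleR_right)
  then show ?thesis by (simp only: partial_x_eq[OF assms] partial_y_eq[OF assms] scaleR_eq_smult)
qed

text \<open>Along velocities \<open>\<zeta>\<close> and \<open>\<i> * \<zeta>\<close> the chain rule
  only brings in the factor \<open>cnj \<zeta>\<close>. In \<open>z_direction\<close> the factor is
  \<open>\<zeta>\<close>, of equal modulus, whence the conformal invariance of the differential
  inequality.\<close>

lemma zbar_direction:
  assumes "z \<in> ball 0 1"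
  shows "blinfun_apply (u' z) \<zeta> + \<i> *s blinfun_apply (u' z) (\<i> * \<zeta>) = (2 * cnj \<zeta>) *s partial_zbar u z"
  unfolding deriv_eq_partials[OF assms] partial_zbar_def
  by (simp add: vec_eq_iff complex_eq_iff algebra_simps)

lemma z_direction:
  assumes "z \<in> ball 0 1"
  shows "blinfun_apply (u' z) \<zeta> - \<i> *s blinfun_apply (u' z) (\<i> * \<zeta>) = (2 * \<zeta>) *s partial_z u z"
  unfolding deriv_eq_partials[OF assms] partial_z_def
  by (simp add: vec_eq_iff complex_eq_iff algebra_simps)

lemma vanishing_disc_grows:
  assumes \<rho>: "0 < \<rho>" "\<rho> < 1 - norm q" and zero: "\<And>z. z \<in> ball q \<rho> \<Longrightarrow> u z = 0"
  obtains \<rho>' where "\<rho> < \<rho>'" "\<rho>' \<le> 1 - norm q" "\<And>z. z \<in> ball q \<rho>' \<Longrightarrow> u z = 0"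
proof -
  \<comment> \<open>The largest disc about \<open>q\<close> inside the unit disc has radius
    \<open>R\<close>; its circle is \<open>x = r\<close> in the coordinates normalized so that the
    circle of radius \<open>\<rho>\<close> is \<open>x = 0\<close>.\<close>
  define R where "R = 1 - norm q"
  define r where "r = ln (R / \<rho>)"
  have R: "\<rho> < R" using \<rho> by (simp add: R_def)
  have r: "r > 0" using R \<rho> by (simp add: r_def)
  have exp_r: "exp r = R / \<rho>" using R \<rho> by (simp add: r_def)
  define e where "e x y = of_real (\<rho> * exp x) * cis y" for x y
  have norm_e: "norm (e x y) = \<rho> * exp x" for x y using \<rho> by (simp add: e_def norm_mult)
  have e_in: "q + e x y \<in> ball 0 1" if "x < r" for x y
  proof -
    have "exp x < R / \<rho>" using that by (simp flip: exp_r)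
    then have "norm (e x y) < R" using \<rho> by (simp add: norm_e field_simps)
    then have "q + e x y \<in> ball q (1 - norm q)" by (simp add: dist_norm R_def)
    then show ?thesis using ball_in_unit_ball by blast
  qed
  \<comment> \<open>The strip setting includes \<open>x = 0\<close>, so the zeros are extended by
    continuity to the bounding circle.\<close>
  have zero': "u z = 0" if "z \<in> cball q \<rho>" for z
  proof -
    have "cball q \<rho> \<subseteq> ball q (1 - norm q)" using \<rho> by auto
    then have "continuous_on (closure (ball q \<rho>)) u"
      using \<rho> ball_in_unit_ball by (intro continuous_on_subset[OF u_cont]) auto
    then show ?thesis
      using continuous_constant_on_closure[of "ball q \<rho>" u 0 z] zero that \<rho> by simp
  qed
  have ex: "((\<lambda>x. q + e x y) has_vector_derivative e x y) (at x)" for x y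
    unfolding e_def by (auto intro!: derivative_eq_intros simp: has_vector_derivative_def scaleR_conv_of_real)
  have ey: "((\<lambda>y. q + e x y) has_vector_derivative \<i> * e x y) (at y)" for x y
    unfolding e_def has_vector_derivative_def
    by (auto intro!: derivative_eq_intros simp: scaleR_conv_of_real)
  have cont_e: "continuous_on S (\<lambda>p. e (fst p) (snd p))" for S
    unfolding e_def by (intro continuous_intros)
  have cont_u': "continuous_on ({..<r} \<times> UNIV) (\<lambda>p. u' (q + e (fst p) (snd p)))"
    by (rule continuous_on_compose2[OF u'_cont]) (use e_in in \<open>auto intro!: continuous_intros cont_e\<close>)
  interpret periodic_strip "\<lambda>x y. u (q + e x y)" "\<lambda>x y. blinfun_apply (u' (q + e x y)) (e x y)"
    "\<lambda>x y. blinfun_apply (u' (q + e x y)) (\<i> * e x y)" "\<lambda>v. \<i> *s v" r K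
  proof
    show "\<i> *s (v + w) = \<i> *s v + \<i> *s w" for v w :: "complex ^ 'n" by (rule vector_add_ldistrib)
    show "\<i> *s (c *\<^sub>R v) = c *\<^sub>R (\<i> *s v)" for c and v :: "complex ^ 'n"
      by (simp add: scaleR_eq_smult vector_smult_assoc mult.commute)
    show "norm (\<i> *s v) = norm v" for v :: "complex ^ 'n" by (simp add: norm_vector_smult)
    show "inner (\<i> *s v) w = - inner v (\<i> *s w)" for v w :: "complex ^ 'n" by (rule inner_i_smult)
    show "((\<lambda>x. u (q + e x y)) has_vector_derivative blinfun_apply (u' (q + e x y)) (e x y)) (at x)"
      if "x < r" for x y by (rule deriv_along[OF e_in[OF that] ex])
    show "((\<lambda>y. u (q + e x y)) has_vector_derivative blinfun_apply (u' (q + e x y)) (\<i> * e x y)) (at y)"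
      if "x < r" for x y by (rule deriv_along[OF e_in[OF that] ey])
    show "continuous_on ({..<r} \<times> UNIV) (\<lambda>(x, y). u (q + e x y))"
      unfolding split_beta
      by (rule continuous_on_compose2[OF u_cont]) (use e_in in \<open>auto intro!: continuous_intros cont_e\<close>)
    show "continuous_on ({..<r} \<times> UNIV) (\<lambda>(x, y). blinfun_apply (u' (q + e x y)) (e x y))"
      "continuous_on ({..<r} \<times> UNIV) (\<lambda>(x, y). blinfun_apply (u' (q + e x y)) (\<i> * e x y))"
      unfolding split_beta by (intro continuous_intros cont_u' cont_e)+
    show "u (q + e x (y + 2 * pi)) = u (q + e x y)" for x y
      by (simp add: e_def cis.ctr)
    show "u (q + e x y) = 0" if "x \<le> 0" for x y
      using that \<rho> by (intro zero') (simp add: dist_norm norm_e mult_left_le)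
    show "r > 0" "K > 0" by (fact r K_pos)+
    show "norm (blinfun_apply (u' (q + e x y)) (e x y) + \<i> *s blinfun_apply (u' (q + e x y)) (\<i> * e x y))
        \<le> K * sqrt (norm (u (q + e x y)))
          * norm (blinfun_apply (u' (q + e x y)) (e x y) - \<i> *s blinfun_apply (u' (q + e x y)) (\<i> * e x y))"
      if "x < r" for x y
      unfolding zbar_direction[OF e_in[OF that]] z_direction[OF e_in[OF that]] norm_vector_smult
      using mult_left_mono[OF zbar_le[OF e_in[OF that]], of "2 * cmod (e x y)"]
      by (simp add: norm_mult powr_half_sqrt mult_ac)
  qed
  obtain s where s: "s > 0" "s < r" "\<And>x y. x \<in> {0..s} \<Longrightarrow> y \<in> {0..2 * pi} \<Longrightarrow> u (q + e x y) = 0"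
    using vanishes_beyond_zero by metis
  show ?thesis
  proof (rule that[of "\<rho> * exp s"])
    show "\<rho> < \<rho> * exp s" using s \<rho> by simp
    have "exp s < R / \<rho>" using s(2) by (simp flip: exp_r)
    then show "\<rho> * exp s \<le> 1 - norm q" using \<rho> by (simp add: R_def field_simps)
    fix z assume z: "z \<in> ball q (\<rho> * exp s)"
    show "u z = 0"
    proof (cases "z \<in> cball q \<rho>")
      case False
      \<comment> \<open>The logarithmic polar coordinates of \<open>z\<close>, with the angle taken
        in the period covered by \<open>s(3)\<close>.\<close>
      define x y where "x = ln (norm (z - q) / \<rho>)" and "y = Arg2pi (z - q)"
      have d: "\<rho> < norm (z - q)" "norm (z - q) < \<rho> * exp s"
        using False z by (auto simp: dist_norm norm_minus_commute)
      have pos: "0 < norm (z - q) / \<rho>" using \<rho>(1) d(1) by (intro divide_pos_pos) linarith+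
      then have "exp x = norm (z - q) / \<rho>" unfolding x_def by (rule exp_ln)
      then have "q + e x y = z"
        using \<rho> cos_Arg2pi[of "z - q"] sin_Arg2pi[of "z - q"] by (simp add: e_def y_def complex_eq_iff)
      moreover have "x \<in> {0..s}"
      proof -
        have "ln (norm (z - q) / \<rho>) \<le> ln (exp s)"
        proof (subst ln_le_cancel_iff[OF pos])
          show "norm (z - q) / \<rho> \<le> exp s" using \<rho>(1) d(2) by (simp add: field_simps)
        qed simp
        then show ?thesis using d \<rho> by (simp add: x_def)
      qed
      moreover have "y \<in> {0..2 * pi}" using Arg2pi[of "z - q"] by (simp add: y_def less_imp_le)
      ultimately show ?thesis using s(3) by metis
    qed (rule zero')
  qed
qed

section \<open>From small discs to the whole unit disc\<close>

text \<open>The supremum of the admissible radii is itself admissible, an open disc being the union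
  of the smaller ones; were it below \<open>1 - norm q\<close>, \<open>vanishing_disc_grows\<close>
  would exceed it.\<close>

lemma vanishes_on_maximal_disc:
  assumes \<rho>: "0 < \<rho>" "\<rho> \<le> 1 - norm q" and zero: "\<And>z. z \<in> ball q \<rho> \<Longrightarrow> u z = 0"
    and z: "z \<in> ball q (1 - norm q)"
  shows "u z = 0"
proof -
  define S where "S = {\<rho>. 0 < \<rho> \<and> \<rho> \<le> 1 - norm q \<and> (\<forall>z\<in>ball q \<rho>. u z = 0)}"
  have S: "S \<noteq> {}" "bdd_above S" using \<rho> zero by (auto simp: S_def)
  have sup_le: "Sup S \<le> 1 - norm q" using S(1) by (intro cSup_least) (auto simp: S_def)
  have "\<rho> \<le> Sup S" using \<rho> zero S by (intro cSup_upper) (auto simp: S_def)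
  then have pos: "0 < Sup S" using \<rho> by simp
  have sup_zero: "u z = 0" if z: "z \<in> ball q (Sup S)" for z
  proof -
    obtain \<sigma> where "\<sigma> \<in> S" "dist q z < \<sigma>" using z less_cSup_iff[OF S, of "dist q z"] by auto
    then show ?thesis by (auto simp: S_def)
  qed
  have "Sup S = 1 - norm q"
  proof (rule ccontr)
    assume "Sup S \<noteq> 1 - norm q"
    then obtain \<sigma> where "Sup S < \<sigma>" "\<sigma> \<le> 1 - norm q" "\<And>z. z \<in> ball q \<sigma> \<Longrightarrow> u z = 0"
      using vanishing_disc_grows[OF pos _ sup_zero] sup_le by (metis order_le_less)
    then have "\<sigma> \<in> S" using pos by (auto simp: S_def)
    then show False using \<open>Sup S < \<sigma>\<close> cSup_upper[OF _ S(2)] by fastforce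
  qed
  then show ?thesis using sup_zero z by simp
qed

text \<open>The interior \<open>Z\<close> of the zero set is also relatively closed, so
  connectedness leaves only the whole disc.\<close>

lemma unique_continuation:
  assumes V: "open V" "V \<noteq> {}" "V \<subseteq> ball 0 1" "\<And>z. z \<in> V \<Longrightarrow> u z = 0" and z: "z \<in> ball 0 1"
  shows "u z = 0"
proof -
  define Z where "Z = interior {z \<in> ball 0 1. u z = 0}"
  have "V \<subseteq> Z" unfolding Z_def using V by (intro interior_maximal) auto
  then have ne: "Z \<noteq> {}" using V by auto
  have Z_sub: "Z \<subseteq> ball 0 1" "\<And>z. z \<in> Z \<Longrightarrow> u z = 0"
    unfolding Z_def using interior_subset by blast+
  have "b \<in> Z" if b: "b \<in> ball 0 1" "b \<in> closure Z" for b
  proof -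
    \<comment> \<open>Half the distance from \<open>b\<close> to the unit circle: a point
      \<open>q\<close> of \<open>Z\<close> within \<open>d\<close> of \<open>b\<close> is more than
      \<open>d\<close> away from the circle, so \<open>b\<close> lies in the maximal disc about
      \<open>q\<close>.\<close>
    define d where "d = (1 - norm b) / 2"
    have d: "d > 0" using b by (simp add: d_def)
    obtain q where q: "q \<in> Z" "dist q b < d" using b(2) d closure_approachable by blast
    have qn: "norm q < 1" using q Z_sub by auto
    obtain \<rho> where \<rho>: "\<rho> > 0" "ball q \<rho> \<subseteq> Z" using q(1) openE[of Z q] by (auto simp: Z_def)
    have "\<forall>z\<in>ball q (1 - norm q). u z = 0"
    proof
      fix z assume "z \<in> ball q (1 - norm q)"
      then show "u z = 0"
        by (rule vanishes_on_maximal_disc[of "min \<rho> (1 - norm q)" q, rotated 3]) (use \<rho> qn Z_sub in auto)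
    qed
    then have "ball q (1 - norm q) \<subseteq> Z"
      unfolding Z_def using ball_in_unit_ball[of q] by (intro interior_maximal) auto
    moreover have "dist q b < 1 - norm q"
      using q(2) norm_triangle_sub[of q b] by (simp add: d_def dist_norm field_simps)
    ultimately show ?thesis by auto
  qed
  then have "Z = ball 0 1 \<inter> closure Z" using Z_sub closure_subset by blast
  then have "closedin (top_of_set (ball 0 1)) Z" by (metis closed_closure closedin_closed_Int)
  moreover have "openin (top_of_set (ball 0 1)) Z"
    using Z_sub by (simp add: Z_def openin_open_eq)
  moreover have "connected (ball (0::complex) 1)" by (simp add: convex_connected)
  ultimately have "Z = ball 0 1" using ne unfolding connected_clopen by metis
  then show ?thesis using z Z_sub by auto
qed

end

theorem proposition3:
  fixes u :: "complex \<Rightarrow> complex ^ 'n" and K :: real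
  assumes "C1_on (ball 0 1) u"
    and "K > 0"
    and "\<And>z. z \<in> ball 0 1 \<Longrightarrow>
           norm (partial_zbar u z) \<le> K * norm (u z) powr (1 / 2) * norm (partial_z u z)"
    and "open V" and "V \<noteq> {}" and "V \<subseteq> ball 0 1"
    and "\<And>z. z \<in> V \<Longrightarrow> u z = 0"
  shows "\<forall>z \<in> ball 0 1. u z = 0"
proof -
  obtain u' where "\<And>z. z \<in> ball 0 1 \<Longrightarrow> (u has_derivative blinfun_apply (u' z)) (at z)"
      "continuous_on (ball 0 1) u'"
    using assms(1) unfolding C1_on_def by blast
  then interpret dbar_map u u' K using assms(2,3) by unfold_locales
  show ?thesis using unique_continuation[OF assms(4-7)] by blast
qed

end
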